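(* Let $\mathbb{K}$ be a field of characteristic $0$ and let $L$ be a split $\delta$ Jordan-Lie algebra over $\mathbb{K}$ (of arbitrary dimension) with a symmetric root system $\Lambda$. Suppose that $L$ is root-multiplicative, $\mathrm{Z}(L)=0$, $[L,L]=L$, and $\dim L_\alpha=1$ for every $\alpha\in\Lambda$. Then $L$ is simple if and only if it has all its nonzero roots connected (that is, any two $\alpha,\beta\in\Lambda$ are connected).
   Context: Let $\delta\in\{1,-1\}$. A $\delta$ Jordan-Lie algebra is a vector space $L$ over a field $\mathbb{K}$ with a bilinear map $[\cdot,\cdot]:L\times L\to L$ satisfying $[x,y]=-\delta[y,x]$ and $[x,[y,z]]=\delta[[x,y],z]+\delta[y,[x,z]]$ for all $x,y,z\in L$. Put $(\mathrm{ad}\,x)y:=\delta[x,y]$. The center is $\mathrm{Z}(L)=\{v\in L:[v,L]=0\}$. A splitting Cartan subalgebra $H$ of $L$ is a maximal abelian subalgebra such that the maps $\mathrm{ad}(h)$, $h\in H$, are simultaneously diagonalizable; $L$ is split if it contains such an $H$ (which is then fixed). This means that there is a root decomposition $L=H\oplus(\oplus_{\alpha\in\Lambda}L_\alpha)$, where for $\alpha\in H^*$, $L_\alpha=\{v\in L:[h,v]=\alpha(h)v\text{ for all }h\in H\}$, and $\Lambda=\{\alpha\in H^*\setminus\{0\}:L_\alpha\neq0\}$ is the root system (the set of nonzero roots). $\Lambda$ is symmetric if $\alpha\in\Lambda$ implies $-\alpha\in\Lambda$. Connections: for $\alpha,\beta\in\Lambda$, $\alpha$ and $\beta$ are connected if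 there are $n\ge1$ and $\alpha_1,\dots,\alpha_n\in\Lambda$ such that, with $s_k:=\delta^{k-1}\alpha_1+\sum_{i=1}^{k-1}\delta^{k-i}\alpha_{i+1}$ (so $s_1=\alpha_1$, $s_2=\delta(\alpha_1+\alpha_2)$, $s_3=\alpha_1+\alpha_2+\delta\alpha_3$, and so on), one has $\alpha_1=\alpha$; $s_1,\dots,s_{n-1}\in\Lambda$ (when $n\ge2$); and $s_n=\pm\beta$. $L$ is root-multiplicative if $\alpha,\beta,\alpha+\beta\in\Lambda$ implies $[L_\alpha,L_\beta]\neq0$. *)

theory Defs
  imports Complex_Main "HOL-Library.Function_Algebras"
begin

text \<open>
  The algebra is the whole type \<open>'v\<close>, of arbitrary dimension over \<open>'k\<close>;
  the sign \<open>\<delta>\<close> is an element of the ground field.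
\<close>

locale delta_jordan_lie = vector_space scale
  for scale :: "'k::field \<Rightarrow> 'v::ab_group_add \<Rightarrow> 'v"  (infixr \<open>*s\<close> 75) +
  fixes \<delta> :: 'k
    and br :: "'v \<Rightarrow> 'v \<Rightarrow> 'v"
  assumes delta: "\<delta> \<in> {1, -1}"
    and br_linear_left: "Vector_Spaces.linear scale scale (\<lambda>x. br x y)"
    and br_linear_right: "Vector_Spaces.linear scale scale (br x)"
    and br_skew: "br x y = - (\<delta> *s br y x)"
    and br_jacobi: "br x (br y z) = \<delta> *s br (br x y) z + \<delta> *s br y (br x z)"
begin

definition ad :: "'v \<Rightarrow> 'v \<Rightarrow> 'v" where
  "ad x y = \<delta> *s br x y"

definition center :: "'v set" where
  "center = {v. \<forall>x. br v x = 0}"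

definition bracket_span :: "'v set \<Rightarrow> 'v set \<Rightarrow> 'v set" where
  "bracket_span A B = span {br x y | x y. x \<in> A \<and> y \<in> B}"

text \<open>By \<open>br_skew\<close>, one-sided absorption already makes an ideal two-sided.\<close>

definition ideal :: "'v set \<Rightarrow> bool" where
  "ideal I \<longleftrightarrow> subspace I \<and> (\<forall>x\<in>I. \<forall>y. br x y \<in> I)"

definition simple :: bool where
  "simple \<longleftrightarrow> bracket_span UNIV UNIV \<noteq> {0} \<and> (\<forall>I. ideal I \<longrightarrow> I = {0} \<or> I = UNIV)"

definition abelian_subalgebra :: "'v set \<Rightarrow> bool" where
  "abelian_subalgebra H \<longleftrightarrow> subspace H \<and> (\<forall>x\<in>H. \<forall>y\<in>H. br x y = 0)"

definition splitting_cartan_subalgebra :: "'v set \<Rightarrow> bool" where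
  "splitting_cartan_subalgebra H \<longleftrightarrow>
     abelian_subalgebra H \<and>
     (\<forall>A. abelian_subalgebra A \<and> H \<subseteq> A \<longrightarrow> A = H) \<and>
     (\<exists>B. independent B \<and> span B = UNIV \<and> (\<forall>b\<in>B. \<forall>h\<in>H. \<exists>c. ad h b = c *s b))"

text \<open>
  A linear form on the subspace \<open>H\<close> is encoded as a function on the whole type that
  vanishes outside \<open>H\<close>.  With this normalisation equality, sums and negatives of
  functions coincide with those of linear forms on \<open>H\<close>.
\<close>

definition dual :: "'v set \<Rightarrow> ('v \<Rightarrow> 'k) set" where
  "dual H = {f. (\<forall>x\<in>H. \<forall>y\<in>H. f (x + y) = f x + f y) \<and>
                (\<forall>c. \<forall>x\<in>H. f (c *s x) = c * f x) \<and>
                (\<forall>x. x \<notin> H \<longrightarrow> f x = 0)}"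

text \<open>There is no factor \<open>\<delta>\<close> here: root spaces are defined by \<open>br h\<close>, not by \<open>ad h\<close>.\<close>

definition root_space :: "'v set \<Rightarrow> ('v \<Rightarrow> 'k) \<Rightarrow> 'v set" where
  "root_space H \<alpha> = {v. \<forall>h\<in>H. br h v = \<alpha> h *s v}"

definition roots :: "'v set \<Rightarrow> ('v \<Rightarrow> 'k) set" where
  "roots H = {\<alpha> \<in> dual H. \<alpha> \<noteq> 0 \<and> root_space H \<alpha> \<noteq> {0}}"

definition symmetric_roots :: "'v set \<Rightarrow> bool" where
  "symmetric_roots H \<longleftrightarrow> (\<forall>\<alpha>\<in>roots H. - \<alpha> \<in> roots H)"

definition root_multiplicative :: "'v set \<Rightarrow> bool" where
  "root_multiplicative H \<longleftrightarrow>
     (\<forall>\<alpha>\<in>roots H. \<forall>\<beta>\<in>roots H. \<alpha> + \<beta> \<in> roots H \<longrightarrow>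
        bracket_span (root_space H \<alpha>) (root_space H \<beta>) \<noteq> {0})"

text \<open>The sequence \<open>a 1, a 2, \<dots>\<close> is indexed from 1; the value \<open>a 0\<close> is never used.\<close>

definition connection_sum :: "(nat \<Rightarrow> 'v \<Rightarrow> 'k) \<Rightarrow> nat \<Rightarrow> 'v \<Rightarrow> 'k" where
  "connection_sum a k =
     (\<lambda>h. \<delta> ^ (k - 1) * a 1 h + (\<Sum>i\<in>{1..<k}. \<delta> ^ (k - i) * a (i + 1) h))"

definition connected_roots :: "'v set \<Rightarrow> ('v \<Rightarrow> 'k) \<Rightarrow> ('v \<Rightarrow> 'k) \<Rightarrow> bool" where
  "connected_roots H \<alpha> \<beta> \<longleftrightarrow>
     (\<exists>n\<ge>1. \<exists>a. (\<forall>i\<in>{1..n}. a i \<in> roots H) \<and> a 1 = \<alpha> \<and>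
        (\<forall>k\<in>{1..<n}. connection_sum a k \<in> roots H) \<and>
        (connection_sum a n = \<beta> \<or> connection_sum a n = - \<beta>))"

end

end

theory Submission
  imports Defs
begin

text \<open>
  For \<open>\<delta> = -1\<close> the Jacobi identity forces every root to vanish, so \<open>H\<close> is central, hence zero; maximality
  of \<open>H\<close> then annihilates all squares and finally the whole algebra. So \<open>\<delta> = 1\<close> and \<open>L\<close> is a Lie algebra.

  If \<open>L\<close> is simple, the centralizer of all root spaces connected to a root \<open>\<alpha>\<close> is an ideal. It contains
  the root spaces not connected to \<open>\<alpha>\<close>, and it is not \<open>L\<close> because the center is zero; hence it is zero and
  every root is connected to \<open>\<alpha>\<close>.

  Conversely, a nonzero ideal \<open>I\<close> is graded and, as the center is zero, meets some root space, so it contains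
  that (one-dimensional) root space. Multiplying along connections, \<open>I\<close> contains one of \<open>L\<^sub>\<beta>\<close>, \<open>L\<^bsub>-\<beta>\<^esub>\<close> for every
  root \<open>\<beta>\<close>, hence \<open>[L\<^sub>\<beta>, L\<^bsub>-\<beta>\<^esub>]\<close>. As \<open>[L, L] = L\<close>, these brackets span \<open>H\<close>; and \<open>H \<subseteq> I\<close> gives \<open>I = L\<close>.
\<close>

section \<open>Bilinear calculus of the bracket, and the case \<delta> = -1\<close>

context delta_jordan_lie
begin

lemma br_add_left: "br (x + y) z = br x z + br y z"
  using br_linear_left[of z] by (simp add: linear_iff_module_hom module_hom_iff)

lemma br_scale_left: "br (c *s x) y = c *s br x y"
  using br_linear_left[of y] by (simp add: linear_iff_module_hom module_hom_iff)

lemma br_add_right: "br x (y + z) = br x y + br x z"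
  using br_linear_right[of x] by (simp add: linear_iff_module_hom module_hom_iff)

lemma br_scale_right: "br x (c *s y) = c *s br x y"
  using br_linear_right[of x] by (simp add: linear_iff_module_hom module_hom_iff)

lemma br_zero_left [simp]: "br 0 y = 0"
  using br_scale_left[of 0 0 y] by simp

lemma br_zero_right [simp]: "br x 0 = 0"
  using br_scale_right[of x 0 0] by simp

lemma br_sum_right: "br x (sum f F) = (\<Sum>i\<in>F. br x (f i))"
  by (induction F rule: infinite_finite_induct) (simp_all add: br_add_right)

lemma subspace_annihilator: "subspace {v. \<forall>x\<in>S. br v x = 0}"
  by (auto simp: subspace_def br_add_left br_scale_left)

lemma center_eq_zeroD:
  assumes "center = {0}" "\<And>y. br v y = 0"
  shows "v = 0"
  using assms by (auto simp: center_def)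

lemma br_span_zero:
  assumes "x \<in> span S" "y \<in> span T" "\<And>a b. a \<in> S \<Longrightarrow> b \<in> T \<Longrightarrow> br a b = 0"
  shows "br x y = 0"
proof -
  have "S \<subseteq> {v. \<forall>b\<in>T. br v b = 0}"
    using assms(3) by blast
  then have "x \<in> {v. \<forall>b\<in>T. br v b = 0}"
    using span_minimal[OF _ subspace_annihilator] assms(1) by blast
  then have "T \<subseteq> {w. br x w = 0}"
    by blast
  moreover have "subspace {w. br x w = 0}"
    by (auto simp: subspace_def br_add_right br_scale_right)
  ultimately show ?thesis
    using span_minimal assms(2) by blast
qed

lemma bracket_span_neq_zeroE:
  assumes "bracket_span A B \<noteq> {0}"
  obtains x y where "x \<in> A" "y \<in> B" "br x y \<noteq> 0"
proof -
  let ?S = "{br x y |x y. x \<in> A \<and> y \<in> B}"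
  have "span ?S = {0}" if "?S \<subseteq> {0}"
    using span_minimal[OF that subspace_single_0] span_zero[of ?S] by blast
  with assms have "\<not> ?S \<subseteq> {0}"
    unfolding bracket_span_def by blast
  then show ?thesis
    using that by blast
qed

lemma abelian_subalgebra_span:
  assumes "\<And>x y. x \<in> S \<Longrightarrow> y \<in> S \<Longrightarrow> br x y = 0"
  shows "abelian_subalgebra (span S)"
  unfolding abelian_subalgebra_def using br_span_zero assms by auto

text \<open>Maximality of \<open>H\<close> restated for generating sets: pairwise vanishing brackets
  on \<open>S\<close> make \<open>span S\<close> an abelian subalgebra, which cannot properly
  contain \<open>H\<close>.\<close>

lemma splitting_cartan_subalgebra_maximal:
  assumes "splitting_cartan_subalgebra H" "\<And>x y. x \<in> S \<Longrightarrow> y \<in> S \<Longrightarrow> br x y = 0" "H \<subseteq> span S"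
  shows "S \<subseteq> H"
proof -
  have "span S = H"
    using assms(1,3) abelian_subalgebra_span[OF assms(2)]
    unfolding splitting_cartan_subalgebra_def by (elim conjE) simp
  then show ?thesis
    using span_superset[of S] by simp
qed

lemma trivial_if_delta_minus_one:
  assumes delta: "\<delta> = -1" and char: "(2::'k) \<noteq> 0" "(3::'k) \<noteq> 0"
    and H: "splitting_cartan_subalgebra H" and center: "center = {0}"
  shows "(UNIV :: 'v set) = {0}"
proof -
  have jac: "br x (br y z) + br (br x y) z + br y (br x z) = 0" for x y z
    using br_jacobi[of x y z] delta by (simp add: algebra_simps)
  have comm: "br x y = br y x" for x y
    using br_skew[of x y] delta by simp
  \<comment> \<open>With x = y = z the three Jacobi terms agree up to commutativity, which leaves
    3[x,[x,x]] = 0.\<close>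
  have cube: "br x (br x x) = 0" for x
  proof -
    have "3 *s br x (br x x) = (1 + 1 + 1) *s br x (br x x)"
      by simp
    also have "\<dots> = 0"
      using jac[of x x x] comm[of "br x x" x] by (simp only: scale_left_distrib scale_one)
    finally show ?thesis
      using char by simp
  qed
  \<comment> \<open>In the Jacobi identity for x, x, [x,x] the two outer terms contain the cube of x
    and vanish.\<close>
  have square: "br (br x x) (br x x) = 0" for x
    using jac[of x x "br x x"] by (simp add: cube)
  obtain B where B: "span B = UNIV" "\<And>b h. b \<in> B \<Longrightarrow> h \<in> H \<Longrightarrow> \<exists>c. ad h b = c *s b"
    and abel: "\<And>x y. x \<in> H \<Longrightarrow> y \<in> H \<Longrightarrow> br x y = 0"
    using H unfolding splitting_cartan_subalgebra_def abelian_subalgebra_def by blast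
  have "h = 0" if "h \<in> H" for h
  proof (rule center_eq_zeroD[OF center])
    fix y
    have "br a b = 0" if ab: "a \<in> {h}" "b \<in> B" for a b
    proof -
      obtain c where c: "ad h b = c *s b"
        using B(2) \<open>h \<in> H\<close> ab(2) by blast
      \<comment> \<open>\<open>ad\<close> carries the factor \<delta> = -1, so the eigenvalue
        changes sign.\<close>
      have c: "br h b = (- c) *s b"
        using arg_cong[OF c[unfolded ad_def], of uminus] by (simp add: delta)
      have "br h (br h b) = (c * c) *s b"
        unfolding c br_scale_right by simp
      \<comment> \<open>Since [h,h] = 0, Jacobi says that twice the square of the action of h
        vanishes; on an eigenvector this forces the eigenvalue to be 0.\<close>
      moreover have "br h (br h b) + br h (br h b) = 0"
        using jac[of h h b] abel[OF \<open>h \<in> H\<close> \<open>h \<in> H\<close>] by simp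
      ultimately have "(2 * (c * c)) *s b = 0"
        by (simp only: mult_2 scale_left_distrib)
      then have "c = 0 \<or> b = 0"
        using char by simp
      with c ab(1) show ?thesis
        by auto
    qed
    then show "br h y = 0"
      using br_span_zero[of h "{h}" y B] B(1) by (simp add: span_base)
  qed
  \<comment> \<open>As \<open>H\<close> is zero, it lies in every span, so maximality applies to any
    commuting set: below first to a single square, then to a single arbitrary element.\<close>
  then have null: "S \<subseteq> {0}" if "\<And>x y. x \<in> S \<Longrightarrow> y \<in> S \<Longrightarrow> br x y = 0" for S
    using splitting_cartan_subalgebra_maximal[OF H that] span_zero[of S] by blast
  have "br x x = 0" for x
    using null[of "{br x x}"] square by auto
  then have "x = 0" for x :: 'v
    using null[of "{x}"] by auto
  then show ?thesis
    by auto
qed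

end

section \<open>Weight decomposition and graded ideals of a split Lie algebra\<close>

locale split_lie = delta_jordan_lie scale 1 br
  for scale :: "'k::field \<Rightarrow> 'v::ab_group_add \<Rightarrow> 'v"  (infixr \<open>*s\<close> 75)
    and br :: "'v \<Rightarrow> 'v \<Rightarrow> 'v" +
  fixes H :: "'v set"
  assumes two_neq_zero: "(2::'k) \<noteq> 0"
    and cartan: "splitting_cartan_subalgebra H"
begin

text \<open>Including 0, whose weight space is \<open>H\<close>, lets the whole root decomposition
  be indexed uniformly.\<close>

abbreviation weights :: "('v \<Rightarrow> 'k) set" where
  "weights \<equiv> insert 0 (roots H)"

lemma br_anticomm: "br x y = - br y x"
  using br_skew[of x y] by simp

lemma jacobi: "br x (br y z) = br (br x y) z + br y (br x z)"
  using br_jacobi[of x y z] by simp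

lemma br_self: "br x x = 0"
proof -
  have "2 *s br x x = (1 + 1) *s br x x"
    by simp
  also have "\<dots> = 0"
    using br_anticomm[of x x] by (simp only: scale_left_distrib scale_one eq_neg_iff_add_eq_0)
  finally show ?thesis
    using two_neq_zero by simp
qed

lemma subspace_cartan: "subspace H"
  using cartan unfolding splitting_cartan_subalgebra_def abelian_subalgebra_def by blast

lemma br_cartan: "x \<in> H \<Longrightarrow> y \<in> H \<Longrightarrow> br x y = 0"
  using cartan unfolding splitting_cartan_subalgebra_def abelian_subalgebra_def by blast

lemma root_spaceD: "v \<in> root_space H \<alpha> \<Longrightarrow> h \<in> H \<Longrightarrow> br h v = \<alpha> h *s v"
  by (simp add: root_space_def)

lemma subspace_root_space: "subspace (root_space H \<alpha>)"
  by (auto simp: subspace_def root_space_def br_add_right br_scale_right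
      scale_right_distrib scale_left_commute)

text \<open>\<open>H\<close> is its own centralizer: an element v commuting with \<open>H\<close>
  also satisfies [v,v] = 0, so adjoining it keeps the span abelian.\<close>

lemma root_space_zero: "root_space H 0 = H"
proof
  show "root_space H 0 \<subseteq> H"
  proof
    fix v assume v: "v \<in> root_space H 0"
    then have hv: "br h v = 0" if "h \<in> H" for h
      using that by (simp add: root_space_def)
    then have vh: "br v h = 0" if "h \<in> H" for h
      using that br_anticomm[of v h] by simp
    have "insert v H \<subseteq> H"
    proof (rule splitting_cartan_subalgebra_maximal[OF cartan])
      show "br x y = 0" if "x \<in> insert v H" "y \<in> insert v H" for x y
        using that hv vh br_self br_cartan by blast
    qed (auto intro: span_base)
    then show "v \<in> H"
      by simp
  qed
qed (auto simp: root_space_def br_cartan)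

text \<open>The bracket with h is a derivation, so eigenvalues add.\<close>

lemma br_root_space:
  assumes "x \<in> root_space H \<alpha>" "y \<in> root_space H \<beta>"
  shows "br x y \<in> root_space H (\<alpha> + \<beta>)"
  unfolding root_space_def
proof clarify
  fix h assume "h \<in> H"
  then show "br h (br x y) = (\<alpha> + \<beta>) h *s br x y"
    using assms jacobi[of h x y]
    by (simp add: root_spaceD br_scale_left br_scale_right scale_left_distrib)
qed

lemma dual_add: "\<alpha> \<in> dual H \<Longrightarrow> \<beta> \<in> dual H \<Longrightarrow> \<alpha> + \<beta> \<in> dual H"
  by (auto simp: dual_def algebra_simps)

lemma dual_eqI: "\<alpha> \<in> dual H \<Longrightarrow> \<beta> \<in> dual H \<Longrightarrow> (\<And>h. h \<in> H \<Longrightarrow> \<alpha> h = \<beta> h) \<Longrightarrow> \<alpha> = \<beta>"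
  by (rule ext) (metis (mono_tags, lifting) dual_def mem_Collect_eq)

lemma weights_dual: "weights \<subseteq> dual H"
  by (auto simp: roots_def dual_def)

lemma weights_add:
  assumes "\<alpha> \<in> weights" "\<beta> \<in> weights" "root_space H (\<alpha> + \<beta>) \<noteq> {0}"
  shows "\<alpha> + \<beta> \<in> weights"
proof -
  have "\<alpha> + \<beta> \<in> dual H"
    using assms(1,2) weights_dual by (intro dual_add) blast+
  with assms(3) show ?thesis
    by (simp add: roots_def)
qed

text \<open>The common eigenbasis consists of weight vectors: a nonzero vector determines its
  eigenvalues, hence these depend linearly on h.\<close>

lemma span_weight_spaces: "span (\<Union>\<alpha>\<in>weights. root_space H \<alpha>) = UNIV"
proof -
  obtain B where B: "independent B" "span B = UNIV"
    "\<And>b h. b \<in> B \<Longrightarrow> h \<in> H \<Longrightarrow> \<exists>c. ad h b = c *s b"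
    using cartan unfolding splitting_cartan_subalgebra_def by (elim conjE exE) blast
  have "B \<subseteq> (\<Union>\<alpha>\<in>weights. root_space H \<alpha>)"
  proof
    fix b assume b: "b \<in> B"
    then have b0: "b \<noteq> 0"
      using B(1) dependent_zero by blast
    \<comment> \<open>The value 0 outside \<open>H\<close> is the normalisation required by
      \<open>dual\<close>.\<close>
    define \<alpha> where "\<alpha> h = (if h \<in> H then SOME c. br h b = c *s b else 0)" for h
    have \<alpha>: "br h b = \<alpha> h *s b" if "h \<in> H" for h
      using someI_ex[of "\<lambda>c. br h b = c *s b"] B(3)[OF b that] that
      by (simp add: \<alpha>_def ad_def)
    have "\<alpha> (x + y) = \<alpha> x + \<alpha> y" if "x \<in> H" "y \<in> H" for x y
    proof -
      have "\<alpha> (x + y) *s b = (\<alpha> x + \<alpha> y) *s b"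
        using that \<alpha> \<alpha>[of "x + y"] subspace_add[OF subspace_cartan]
        by (simp add: br_add_left scale_left_distrib)
      then show ?thesis
        using b0 by simp
    qed
    moreover have "\<alpha> (c *s x) = c * \<alpha> x" if "x \<in> H" for x c
    proof -
      have "\<alpha> (c *s x) *s b = (c * \<alpha> x) *s b"
        using that \<alpha> \<alpha>[of "c *s x"] subspace_scale[OF subspace_cartan]
        by (auto simp: br_scale_left)
      then show ?thesis
        using b0 by simp
    qed
    moreover have "\<alpha> x = 0" if "x \<notin> H" for x
      using that by (simp add: \<alpha>_def)
    ultimately have dual: "\<alpha> \<in> dual H"
      by (auto simp: dual_def)
    have "b \<in> root_space H \<alpha>"
      using \<alpha> by (simp add: root_space_def)
    moreover from this have "\<alpha> \<in> weights"
      using dual b0 by (auto simp: roots_def)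
    ultimately show "b \<in> (\<Union>\<alpha>\<in>weights. root_space H \<alpha>)"
      by blast
  qed
  from span_mono[OF this] show ?thesis
    using B(2) by auto
qed

text \<open>Reduces statements that are linear in an element to weight vectors.\<close>

lemma UNIV_weight_induct [consumes 1, case_names weight]:
  assumes "subspace S"
    and "\<And>\<alpha> x. \<alpha> \<in> weights \<Longrightarrow> x \<in> root_space H \<alpha> \<Longrightarrow> x \<in> S"
  shows "v \<in> S"
proof -
  have "(\<Union>\<alpha>\<in>weights. root_space H \<alpha>) \<subseteq> S"
    using assms(2) by blast
  from span_minimal[OF this assms(1)] show ?thesis
    unfolding span_weight_spaces by blast
qed

lemma span_weight_decomposition:
  assumes "v \<in> span (\<Union>\<alpha>\<in>A. root_space H \<alpha>)"
  obtains F x where "finite F" "F \<subseteq> A" "\<And>\<alpha>. x \<alpha> \<in> root_space H \<alpha>" "v = sum x F"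
proof -
  \<comment> \<open>The induction also carries that x vanishes outside F. A further vector of weight
    \<mu> is then absorbed by updating x at \<mu>, whether or not \<mu> already occurs in F.\<close>
  have "\<exists>F x. finite F \<and> F \<subseteq> A \<and> (\<forall>\<alpha>. x \<alpha> \<in> root_space H \<alpha>) \<and> (\<forall>\<alpha>. \<alpha> \<notin> F \<longrightarrow> x \<alpha> = 0) \<and> v = sum x F"
    using assms
  proof (induction rule: span_induct_alt)
    case base
    then show ?case
      by (intro exI[of _ "{}"] exI[of _ "\<lambda>_. 0"]) (simp add: subspace_0[OF subspace_root_space])
  next
    case (step c b y)
    obtain F x where F: "finite F" "F \<subseteq> A" "\<And>\<alpha>. x \<alpha> \<in> root_space H \<alpha>"
      "\<And>\<alpha>. \<alpha> \<notin> F \<Longrightarrow> x \<alpha> = 0" "y = sum x F"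
      using step(2) by blast
    obtain \<mu> where \<mu>: "\<mu> \<in> A" "b \<in> root_space H \<mu>"
      using step(1) by blast
    have "sum x (insert \<mu> F) = sum x F"
      using F(1,4) by (intro sum.mono_neutral_right) auto
    then have "c *s b + y = c *s b + x \<mu> + sum x (F - {\<mu>})"
      using F(1,5) sum.remove[of "insert \<mu> F" \<mu> x] by (simp add: add.assoc)
    also have "\<dots> = sum (x(\<mu> := c *s b + x \<mu>)) (insert \<mu> F)"
      using F(1) sum.remove[of "insert \<mu> F" \<mu> "x(\<mu> := c *s b + x \<mu>)"]
      by (simp cong: sum.cong_simp)
    finally show ?case
      using F \<mu> subspace_add[OF subspace_root_space subspace_scale[OF subspace_root_space]]
      by (intro exI[of _ "insert \<mu> F"] exI[of _ "x(\<mu> := c *s b + x \<mu>)"]) auto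
  qed
  then show ?thesis
    using that by blast
qed

text \<open>Ideals are graded because distinct weights differ at some h in \<open>H\<close>. Such an
  h eliminates one component inside the ideal, induction yields the others, and subtraction recovers
  the eliminated one.\<close>

lemma ideal_weight_component:
  assumes I: "ideal I" and "finite F" "F \<subseteq> weights" "\<And>\<alpha>. \<alpha> \<in> F \<Longrightarrow> x \<alpha> \<in> root_space H \<alpha>"
    and "sum x F \<in> I" "\<alpha> \<in> F"
  shows "x \<alpha> \<in> I"
  using assms(2-)
proof (induction F arbitrary: x \<alpha> rule: finite_induct)
  case (insert \<mu> F)
  have sub: "subspace I" and absorb: "\<And>v y. v \<in> I \<Longrightarrow> br v y \<in> I"
    using I by (auto simp: ideal_def)
  have F: "x \<kappa> \<in> I" if \<kappa>: "\<kappa> \<in> F" for \<kappa>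
  proof -
    have "\<kappa> \<in> dual H" "\<mu> \<in> dual H" "\<kappa> \<noteq> \<mu>"
      using insert.hyps(2) insert.prems(1) \<kappa> weights_dual by blast+
    then obtain h where h: "h \<in> H" "\<kappa> h \<noteq> \<mu> h"
      using dual_eqI by blast
    let ?v = "sum x (insert \<mu> F)"
    have brh: "br h (x \<nu>) = \<nu> h *s x \<nu>" if "\<nu> \<in> insert \<mu> F" for \<nu>
      using root_spaceD[OF insert.prems(2)[OF that] h(1)] .
    \<comment> \<open>Applying \<open>ad h - \<mu> h\<close> kills the component of weight \<open>\<mu>\<close> and rescales the others.\<close>
    have "br h ?v - \<mu> h *s ?v = (\<Sum>\<nu>\<in>insert \<mu> F. (\<nu> h - \<mu> h) *s x \<nu>)"
      unfolding br_sum_right scale_sum_right sum_subtractf[symmetric]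
      by (intro sum.cong) (simp_all add: brh scale_left_diff_distrib)
    also have "\<dots> = (\<Sum>\<nu>\<in>F. (\<nu> h - \<mu> h) *s x \<nu>)"
      using insert by simp
    finally have eq: "br h ?v - \<mu> h *s ?v = (\<Sum>\<nu>\<in>F. (\<nu> h - \<mu> h) *s x \<nu>)" .
    \<comment> \<open>\<open>ideal\<close> absorbs with its element in the first slot, hence the
      switch to -[v,h].\<close>
    have "br h ?v - \<mu> h *s ?v \<in> I"
      unfolding br_anticomm[of h ?v]
      by (intro subspace_diff[OF sub] subspace_neg[OF sub] subspace_scale[OF sub] absorb insert.prems(3))
    then have "(\<kappa> h - \<mu> h) *s x \<kappa> \<in> I"
      using insert.IH[of "\<lambda>\<nu>. (\<nu> h - \<mu> h) *s x \<nu>" \<kappa>] insert.prems \<kappa>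
        subspace_scale[OF subspace_root_space] unfolding eq by blast
    then have "inverse (\<kappa> h - \<mu> h) *s (\<kappa> h - \<mu> h) *s x \<kappa> \<in> I"
      using subspace_scale[OF sub] by blast
    then show ?thesis
      using h by simp
  qed
  have "x \<mu> = sum x (insert \<mu> F) - sum x F"
    using insert by simp
  then have "x \<mu> \<in> I"
    by (simp only:) (rule subspace_diff[OF sub insert.prems(3) subspace_sum[OF sub F]])
  then show ?case
    using F insert.prems(4) by blast
qed simp

section \<open>Connections as partial sums of roots\<close>

lemma connection_sum_one [simp]: "connection_sum a (Suc 0) = a (Suc 0)"
  by (simp add: connection_sum_def)

text \<open>For \<delta> = 1 all sign factors disappear and the connection sums are ordinary partial
  sums.\<close>

lemma connection_sum_Suc:
  "k \<ge> 1 \<Longrightarrow> connection_sum a (Suc k) = connection_sum a k + a (Suc k)"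
  by (rule ext) (simp add: connection_sum_def)

lemma connection_sum_cong:
  "k \<ge> 1 \<Longrightarrow> (\<And>i. i \<in> {1..k} \<Longrightarrow> a i = b i) \<Longrightarrow> connection_sum a k = connection_sum b k"
  by (rule ext) (auto simp: connection_sum_def intro!: sum.cong)

lemma connected_roots_refl: "\<alpha> \<in> roots H \<Longrightarrow> connected_roots H \<alpha> \<alpha>"
  unfolding connected_roots_def by (intro exI[of _ 1] conjI exI[of _ "\<lambda>_. \<alpha>"]) auto

lemma connected_roots_uminus: "connected_roots H \<alpha> \<beta> \<Longrightarrow> connected_roots H \<alpha> (- \<beta>)"
  unfolding connected_roots_def by auto

text \<open>Induction along the partial sums of a connection. It may end in either sign of \<beta>,
  hence the disjunction; both signs are required to be roots so that the last partial sum, too, is a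
  root.\<close>

lemma connected_roots_induct [consumes 2, case_names refl add]:
  assumes "connected_roots H \<alpha> \<beta>" "\<beta> \<in> roots H \<and> - \<beta> \<in> roots H"
    and "P \<alpha>"
    and "\<And>\<sigma> \<gamma>. \<sigma> \<in> roots H \<Longrightarrow> \<gamma> \<in> roots H \<Longrightarrow> \<sigma> + \<gamma> \<in> roots H \<Longrightarrow> P \<sigma> \<Longrightarrow> P (\<sigma> + \<gamma>)"
  shows "P \<beta> \<or> P (- \<beta>)"
proof -
  obtain n a where n: "n \<ge> 1" "\<And>i. i \<in> {1..n} \<Longrightarrow> a i \<in> roots H" "a 1 = \<alpha>"
    "\<And>k. k \<in> {1..<n} \<Longrightarrow> connection_sum a k \<in> roots H"
    "connection_sum a n = \<beta> \<or> connection_sum a n = - \<beta>"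
    using assms(1) unfolding connected_roots_def by blast
  have sums: "connection_sum a k \<in> roots H" if "1 \<le> k" "k \<le> n" for k
    using n(4)[of k] n(5) assms(2) that by (cases "k = n") auto
  have "k \<le> n \<Longrightarrow> P (connection_sum a k)" if "1 \<le> k" for k
    using that
  proof (induction k rule: dec_induct)
    case base
    then show ?case
      using n(3) assms(3) by simp
  next
    case (step k)
    have "P (connection_sum a k + a (Suc k))"
      using step sums[of k] sums[of "Suc k"] n(2)[of "Suc k"]
      by (intro assms(4)) (simp_all flip: connection_sum_Suc)
    then show ?case
      using connection_sum_Suc[OF step(1), of a] by metis
  qed
  with n(1,5) show ?thesis
    by fastforce
qed

end

section \<open>Symmetric root systems, and connectedness in a simple algebra\<close>

locale symmetric_split_lie = split_lie scale br H
  for scale :: "'k::field \<Rightarrow> 'v::ab_group_add \<Rightarrow> 'v"  (infixr \<open>*s\<close> 75)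
    and br :: "'v \<Rightarrow> 'v \<Rightarrow> 'v"
    and H :: "'v set" +
  assumes symmetric: "symmetric_roots H"
    and center_zero: "center = {0}"
begin

lemma roots_uminus: "\<alpha> \<in> roots H \<Longrightarrow> - \<alpha> \<in> roots H"
  using symmetric by (simp add: symmetric_roots_def)

text \<open>One entry is appended to the connection. The former end point becomes an intermediate
  sum, so it must be a root with either sign; symmetry ensures this.\<close>

lemma connected_roots_add:
  assumes conn: "connected_roots H \<alpha> \<beta>" and "\<beta> \<in> roots H" "\<gamma> \<in> roots H"
  shows "connected_roots H \<alpha> (\<beta> + \<gamma>)"
proof -
  obtain n a where n: "n \<ge> 1" "\<And>i. i \<in> {1..n} \<Longrightarrow> a i \<in> roots H" "a 1 = \<alpha>"
    "\<And>k. k \<in> {1..<n} \<Longrightarrow> connection_sum a k \<in> roots H"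
    "connection_sum a n = \<beta> \<or> connection_sum a n = - \<beta>"
    using conn unfolding connected_roots_def by blast
  \<comment> \<open>A connection ending in \<open>- \<beta>\<close> is continued by \<open>- \<gamma>\<close>.\<close>
  define b where "b = a(Suc n := if connection_sum a n = \<beta> then \<gamma> else - \<gamma>)"
  have sums: "connection_sum b k = connection_sum a k" if "k \<in> {1..n}" for k
    using that by (intro connection_sum_cong) (auto simp: b_def)
  have "connection_sum b (Suc n) = connection_sum a n + b (Suc n)"
    using n(1) sums[of n] by (simp add: connection_sum_Suc)
  then have "connection_sum b (Suc n) = \<beta> + \<gamma> \<or> connection_sum b (Suc n) = - (\<beta> + \<gamma>)"
    using n(5) by (auto simp: b_def)
  moreover have "connection_sum b k \<in> roots H" if "k \<in> {1..<Suc n}" for k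
    using that n(4)[of k] n(5) sums[of k] assms(2) roots_uminus by (cases "k = n") auto
  moreover have "b i \<in> roots H" if "i \<in> {1..Suc n}" for i
    using that n(2)[of i] assms(3) roots_uminus by (auto simp: b_def)
  moreover have "b 1 = \<alpha>"
    using n(1,3) by (simp add: b_def)
  ultimately show ?thesis
    unfolding connected_roots_def by (intro exI[of _ "Suc n"] conjI exI[of _ b]) auto
qed

lemma simple_imp_connected:
  assumes simple: "simple" and \<alpha>: "\<alpha> \<in> roots H" and \<gamma>: "\<gamma> \<in> roots H"
  shows "connected_roots H \<alpha> \<gamma>"
proof (rule ccontr)
  assume not_conn: "\<not> connected_roots H \<alpha> \<gamma>"
  define C where "C = {\<beta> \<in> roots H. connected_roots H \<alpha> \<beta>}"
  have C_uminus: "- \<beta> \<in> C" if "\<beta> \<in> C" for \<beta>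
    using that roots_uminus connected_roots_uminus by (simp add: C_def)
  have C_add: "\<beta> + \<mu> \<in> C" if "\<beta> \<in> C" "\<mu> \<in> roots H" "\<beta> + \<mu> \<in> roots H" for \<beta> \<mu>
    using that connected_roots_add by (simp add: C_def)
  \<comment> \<open>The centralizer of the root spaces in the connection class of \<alpha>.\<close>
  define J where "J = {v. \<forall>x\<in>(\<Union>\<beta>\<in>C. root_space H \<beta>). br v x = 0}"
  have J: "br v x = 0" if "v \<in> J" "\<beta> \<in> C" "x \<in> root_space H \<beta>" for v x \<beta>
    using that by (auto simp: J_def)
  have subJ: "subspace J"
    unfolding J_def by (rule subspace_annihilator)
  have "ideal J"
    unfolding ideal_def
  proof (intro conjI ballI allI)
    fix v z assume v: "v \<in> J"
    have "subspace {z. br v z \<in> J}"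
      using subJ by (auto simp: subspace_def br_add_right br_scale_right)
    then have "z \<in> {z. br v z \<in> J}"
    proof (induction rule: UNIV_weight_induct)
      case (weight \<mu> y)
      have "br (br v y) x = 0" if \<beta>: "\<beta> \<in> C" and x: "x \<in> root_space H \<beta>" for \<beta> x
      proof -
        have "br (br v y) x = br v (br y x)"
          using jacobi[of v y x] J[OF v \<beta> x] by simp
        also have "\<dots> = 0"
        \<comment> \<open>If the weights cancel, [y,x] lies in \<open>H\<close>, where membership of
          v in \<open>J\<close> gives no direct information. But then y itself has weight in
          \<open>C\<close>, so v kills both x and y and Jacobi applies. Otherwise a nonzero [y,x]
          has its weight in \<open>C\<close>.\<close>
        proof (cases "\<mu> + \<beta> = 0")
          case True
          then have "\<mu> = - \<beta>"
            by (simp add: eq_neg_iff_add_eq_0)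
          then have "y \<in> root_space H (- \<beta>)"
            using weight by simp
          then have "br v y = 0"
            using J v C_uminus[OF \<beta>] by blast
          then show ?thesis
            using jacobi[of v y x] J[OF v \<beta> x] by simp
        next
          case False
          have yx: "br y x \<in> root_space H (\<beta> + \<mu>)"
            using br_root_space[OF weight(2) x] by (simp add: add.commute)
          show ?thesis
          proof (cases "br y x = 0")
            case nz: False
            then have "\<beta> + \<mu> \<in> roots H"
              using yx weights_add[of \<beta> \<mu>] weight(1) \<beta> False by (auto simp: C_def add.commute)
            then have "\<beta> + \<mu> \<in> C"
              using C_add[OF \<beta>] weight(1) \<beta> by auto
            then show ?thesis
              using J[OF v _ yx] by blast
          qed simp
        qed
        finally show ?thesis .
      qed
      then show ?case
        by (auto simp: J_def)
    qed
    then show "br v z \<in> J"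
      by simp
  qed (rule subJ)
  moreover have "J \<noteq> UNIV"
  proof
    assume "J = UNIV"
    obtain x where x: "x \<in> root_space H \<alpha>" "x \<noteq> 0"
      using \<alpha> subspace_0[OF subspace_root_space] by (auto simp: roots_def)
    have "\<alpha> \<in> C"
      using \<alpha> connected_roots_refl by (simp add: C_def)
    then have "br x v = 0" for v
      using J[of v \<alpha> x] x(1) \<open>J = UNIV\<close> br_anticomm[of x v] by simp
    then show False
      using center_eq_zeroD[OF center_zero] x(2) by blast
  qed
  moreover have "J \<noteq> {0}"
  proof -
    obtain y where y: "y \<in> root_space H \<gamma>" "y \<noteq> 0"
      using \<gamma> subspace_0[OF subspace_root_space] by (auto simp: roots_def)
    \<comment> \<open>A nonzero bracket would connect \<gamma> to \<alpha>: either \<gamma> =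
      -\<beta>, or \<beta> + \<gamma> is in \<open>C\<close> and adding -\<beta> leads to
      \<gamma>.\<close>
    have "br y x = 0" if \<beta>: "\<beta> \<in> C" and x: "x \<in> root_space H \<beta>" for \<beta> x
    proof (rule ccontr)
      assume "br y x \<noteq> 0"
      moreover have "br y x \<in> root_space H (\<beta> + \<gamma>)"
        using br_root_space[OF y(1) x] by (simp add: add.commute)
      ultimately consider "\<beta> + \<gamma> = 0" | "\<beta> + \<gamma> \<in> roots H"
        using weights_add[of \<beta> \<gamma>] \<beta> \<gamma> by (auto simp: C_def)
      then have "\<gamma> \<in> C"
      proof cases
        case 1
        then have "\<gamma> = - \<beta>"
          by (simp add: eq_neg_iff_add_eq_0 add.commute)
        then show ?thesis
          using C_uminus[OF \<beta>] by simp
      next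
        case 2
        then have "\<beta> + \<gamma> \<in> C"
          using C_add \<beta> \<gamma> by blast
        moreover have "- \<beta> \<in> roots H"
          using C_uminus[OF \<beta>] by (simp add: C_def)
        ultimately have "(\<beta> + \<gamma>) + - \<beta> \<in> C"
          using C_add[of "\<beta> + \<gamma>" "- \<beta>"] \<gamma> by simp
        then show ?thesis
          by simp
      qed
      then show False
        using not_conn by (simp add: C_def)
    qed
    then have "y \<in> J"
      by (auto simp: J_def)
    then show ?thesis
      using y(2) by blast
  qed
  ultimately show False
    using simple unfolding simple_def by blast
qed

section \<open>Nonzero ideals, and simplicity from connectedness\<close>

lemma ideal_meets_root_space:
  assumes I: "ideal I" "I \<noteq> {0}"
  obtains \<alpha> x where "\<alpha> \<in> roots H" "x \<in> root_space H \<alpha>" "x \<in> I" "x \<noteq> 0"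
proof -
  have sub: "subspace I" and absorb: "\<And>v y. v \<in> I \<Longrightarrow> br v y \<in> I"
    using I by (auto simp: ideal_def)
  \<comment> \<open>By grading, an ideal without nonzero root vectors lies in \<open>H\<close>. For
    v in it and y of weight \<alpha>, [v,y] is a multiple of y inside the ideal, hence 0; so v is
    central.\<close>
  have False if none: "\<And>\<alpha> x. \<alpha> \<in> roots H \<Longrightarrow> x \<in> root_space H \<alpha> \<Longrightarrow> x \<in> I \<Longrightarrow> x = 0"
  proof -
    obtain v where v: "v \<in> I" "v \<noteq> 0"
      using I(2) subspace_0[OF sub] by blast
    obtain F x where F: "finite F" "F \<subseteq> weights" "\<And>\<alpha>. x \<alpha> \<in> root_space H \<alpha>" "v = sum x F"
      using span_weight_decomposition[of v weights] span_weight_spaces by blast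
    have "x \<alpha> \<in> H" if "\<alpha> \<in> F" for \<alpha>
    proof (cases "\<alpha> = 0")
      case True
      then show ?thesis
        using F(3)[of \<alpha>] root_space_zero by simp
    next
      case False
      then have "x \<alpha> = 0"
        using ideal_weight_component[OF I(1) F(1,2,3)] F that v(1) none[of \<alpha> "x \<alpha>"] by blast
      then show ?thesis
        using subspace_0[OF subspace_cartan] by simp
    qed
    then have vH: "v \<in> H"
      unfolding F(4) by (rule subspace_sum[OF subspace_cartan])
    have "br v y = 0" for y
    proof -
      have "subspace {y. br v y = 0}"
        by (auto simp: subspace_def br_add_right br_scale_right)
      then have "y \<in> {y. br v y = 0}"
      proof (induction rule: UNIV_weight_induct)
        case (weight \<alpha> y)
        have "br v y = \<alpha> v *s y"
          using root_spaceD weight(2) vH by blast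
        then have "br v y \<in> root_space H \<alpha>" "\<alpha> = 0 \<Longrightarrow> br v y = 0"
          using weight(2) subspace_scale[OF subspace_root_space] by simp_all
        then show ?case
          using none[OF _ _ absorb[OF v(1)]] weight(1) by blast
      qed
      then show ?thesis
        by simp
    qed
    then show False
      using center_eq_zeroD[OF center_zero] v(2) by blast
  qed
  then show ?thesis
    using that by blast
qed

text \<open>One root space of each opposite pair puts the bracket of the pair into \<open>I\<close>.
  Perfectness then makes the algebra the sum of \<open>I\<close> and the root spaces; grading gives
  \<open>H\<close> inside \<open>I\<close>, and \<open>H\<close> reproduces every root
  vector.\<close>

lemma ideal_eq_UNIV_if_half_roots:
  assumes I: "ideal I" and perfect: "bracket_span UNIV UNIV = UNIV"
    and half: "\<And>\<beta>. \<beta> \<in> roots H \<Longrightarrow> root_space H \<beta> \<subseteq> I \<or> root_space H (- \<beta>) \<subseteq> I"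
  shows "I = UNIV"
proof -
  have sub: "subspace I" and absorb: "\<And>v y. v \<in> I \<Longrightarrow> br v y \<in> I"
    using I by (auto simp: ideal_def)
  have absorb': "br v y \<in> I" if "y \<in> I" for v y
    using absorb[OF that, of v] br_anticomm[of v y] subspace_neg[OF sub] by simp
  let ?R = "span (\<Union>\<alpha>\<in>roots H. root_space H \<alpha>)"
  let ?S = "{u + w |u w. u \<in> I \<and> w \<in> ?R}"
  have subS: "subspace ?S"
    by (rule subspace_sums[OF sub subspace_span])
  have IS: "I \<subseteq> ?S" and RS: "?R \<subseteq> ?S"
    using subspace_0[OF sub] span_zero by force+
  have homogeneous: "br x y \<in> ?S"
    if "\<kappa> \<in> weights" "x \<in> root_space H \<kappa>" "\<mu> \<in> weights" "y \<in> root_space H \<mu>" for \<kappa> \<mu> x y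
  proof (cases "br x y = 0")
    case True
    then show ?thesis
      using subspace_0[OF subS] by simp
  next
    case False
    have xy: "br x y \<in> root_space H (\<kappa> + \<mu>)"
      using br_root_space that by blast
    then have w: "\<kappa> + \<mu> \<in> weights"
      using weights_add that False by blast
    show ?thesis
    proof (cases "\<kappa> + \<mu> = 0")
      \<comment> \<open>Only opposite weights have brackets in \<open>H\<close>; both being 0 is
        excluded since \<open>H\<close> is abelian, so \<open>half\<close> applies to a genuine
        root.\<close>
      case True
      have "\<kappa> \<noteq> 0"
      proof
        assume "\<kappa> = 0"
        then have "x \<in> H" "y \<in> H"
          using that True root_space_zero by auto
        then show False
          using br_cartan False by blast
      qed
      moreover have "\<mu> = - \<kappa>"
        using True by (simp add: eq_neg_iff_add_eq_0 add.commute)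
      ultimately have "x \<in> I \<or> y \<in> I"
        using half[of \<kappa>] that by auto
      then have "br x y \<in> I"
        using absorb absorb' by blast
      then show ?thesis
        using IS by blast
    next
      case False
      then have "br x y \<in> ?R"
        using xy w by (intro span_base) auto
      then show ?thesis
        using RS by blast
    qed
  qed
  have "br x y \<in> ?S" for x y
  proof -
    have half_hom: "br x y \<in> ?S" if "\<mu> \<in> weights" "y \<in> root_space H \<mu>" for \<mu> x y
    proof -
      have "subspace {x. br x y \<in> ?S}"
        unfolding subspace_def mem_Collect_eq[of _ "\<lambda>x. br x y \<in> ?S"] br_add_left br_scale_left
        using subspace_0[OF subS] subspace_add[OF subS] subspace_scale[OF subS] by simp
      then have "x \<in> {x. br x y \<in> ?S}"
        by (induction rule: UNIV_weight_induct) (use homogeneous that in blast)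
      then show ?thesis
        by simp
    qed
    have "subspace {y. br x y \<in> ?S}"
      unfolding subspace_def mem_Collect_eq[of _ "\<lambda>y. br x y \<in> ?S"] br_add_right br_scale_right
      using subspace_0[OF subS] subspace_add[OF subS] subspace_scale[OF subS] by simp
    then have "y \<in> {y. br x y \<in> ?S}"
      by (induction rule: UNIV_weight_induct) (use half_hom in blast)
    then show ?thesis
      by simp
  qed
  then have "span {br x y |x y. x \<in> UNIV \<and> y \<in> UNIV} \<subseteq> ?S"
    by (intro span_minimal[OF _ subS]) blast
  then have S: "?S = UNIV"
    using perfect unfolding bracket_span_def by blast
  have HI: "H \<subseteq> I"
  proof
    fix h assume h: "h \<in> H"
    have "h \<in> ?S"
      using S by blast
    then obtain u w where uw: "u \<in> I" "w \<in> ?R" "h = u + w"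
      by blast
    obtain F x where F: "finite F" "F \<subseteq> roots H" "\<And>\<alpha>. x \<alpha> \<in> root_space H \<alpha>" "w = sum x F"
      using span_weight_decomposition uw(2) by blast
    have "0 \<notin> F"
      using F(2) by (auto simp: roots_def)
    \<comment> \<open>These are the weight components of u = h - w, an element of \<open>I\<close>;
      the one of weight 0 is h.\<close>
    define x' where "x' \<alpha> = (if \<alpha> = 0 then h else - x \<alpha>)" for \<alpha>
    have "sum x' F = - w"
      unfolding F(4) sum_negf[symmetric] using \<open>0 \<notin> F\<close> by (intro sum.cong) (auto simp: x'_def)
    then have "sum x' (insert 0 F) = u"
      using F(1) \<open>0 \<notin> F\<close> uw(3) by (simp add: x'_def)
    moreover have "x' \<alpha> \<in> root_space H \<alpha>" for \<alpha>
      using h root_space_zero F(3) subspace_neg[OF subspace_root_space] by (simp add: x'_def)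
    ultimately have "x' 0 \<in> I"
      using ideal_weight_component[OF I, of "insert 0 F" x' 0] F(1,2) uw(1) by blast
    then show "h \<in> I"
      by (simp add: x'_def)
  qed
  have "v \<in> I" for v
    using sub
  proof (induction rule: UNIV_weight_induct)
    case (weight \<alpha> y)
    show ?case
    proof (cases "\<alpha> = 0")
      case True
      then show ?thesis
        using weight root_space_zero HI by auto
    next
      case False
      \<comment> \<open>Such an h lies in \<open>H\<close>, as forms vanish outside it; dividing
        [h,y] by the eigenvalue returns y.\<close>
      then obtain h where h: "\<alpha> h \<noteq> 0"
        by fastforce
      then have "h \<in> H"
        using weight(1) weights_dual by (auto simp: dual_def)
      then have "\<alpha> h *s y \<in> I"
        using root_spaceD[OF weight(2)] absorb[of h y] HI by auto
      then have "inverse (\<alpha> h) *s \<alpha> h *s y \<in> I"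
        using subspace_scale[OF sub] by blast
      then show ?thesis
        using h by simp
    qed
  qed
  then show ?thesis
    by blast
qed

lemma connected_imp_simple:
  assumes mult: "root_multiplicative H" and perfect: "bracket_span UNIV UNIV = UNIV"
    and nontriv: "(UNIV :: 'v set) \<noteq> {0}"
    and dim_one: "\<And>\<alpha>. \<alpha> \<in> roots H \<Longrightarrow> dim (root_space H \<alpha>) = 1"
    and conn: "\<And>\<alpha> \<beta>. \<alpha> \<in> roots H \<Longrightarrow> \<beta> \<in> roots H \<Longrightarrow> connected_roots H \<alpha> \<beta>"
  shows "simple"
proof -
  have "I = UNIV" if I: "ideal I" and nz: "I \<noteq> {0}" for I
  proof -
    have sub: "subspace I" and absorb: "\<And>v y. v \<in> I \<Longrightarrow> br v y \<in> I"
      using I by (auto simp: ideal_def)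
    \<comment> \<open>One-dimensionality: a single nonzero root vector in the ideal brings its whole
      root space.\<close>
    have line: "root_space H \<alpha> \<subseteq> I"
      if \<alpha>: "\<alpha> \<in> roots H" and x: "x \<in> root_space H \<alpha>" "x \<in> I" "x \<noteq> 0" for \<alpha> x
    proof -
      obtain B where B: "root_space H \<alpha> \<subseteq> span B" "card B = dim (root_space H \<alpha>)"
        using basis_exists[of "root_space H \<alpha>"] by blast
      moreover have "card B = 1"
        using B(2) dim_one[OF \<alpha>] by simp
      ultimately obtain b where b: "root_space H \<alpha> \<subseteq> span {b}"
        by (elim card_1_singletonE) blast
      then obtain c where c: "x = c *s b"
        using x(1) span_breakdown_eq[of x b "{}"] by auto
      then have "inverse c *s x = b"
        using x(3) by auto
      then have "b \<in> I"
        using subspace_scale[OF sub x(2)] by metis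
      then show ?thesis
        using b span_minimal[OF _ sub, of "{b}"] by blast
    qed
    obtain \<alpha> x where \<alpha>: "\<alpha> \<in> roots H" "x \<in> root_space H \<alpha>" "x \<in> I" "x \<noteq> 0"
      using ideal_meets_root_space[OF I nz] .
    \<comment> \<open>Inclusion in \<open>I\<close> propagates along the partial sums:
      root-multiplicativity supplies a nonzero bracket in the next root space, and
      \<open>line\<close> enlarges it to that space.\<close>
    have half: "root_space H \<beta> \<subseteq> I \<or> root_space H (- \<beta>) \<subseteq> I" if \<beta>: "\<beta> \<in> roots H" for \<beta>
      using conn[OF \<alpha>(1) \<beta>] conjI[OF \<beta> roots_uminus[OF \<beta>]]
    proof (induction rule: connected_roots_induct)
      case refl
      show ?case
        using line[OF \<alpha>] .
    next
      case (add \<sigma> \<gamma>)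
      have "bracket_span (root_space H \<sigma>) (root_space H \<gamma>) \<noteq> {0}"
        using mult add(1-3) by (simp add: root_multiplicative_def)
      then obtain y z where yz: "y \<in> root_space H \<sigma>" "z \<in> root_space H \<gamma>" "br y z \<noteq> 0"
        by (rule bracket_span_neq_zeroE)
      then show ?case
        using line[OF add(3) br_root_space[OF yz(1,2)]] add(4) absorb by blast
    qed
    show ?thesis
      using ideal_eq_UNIV_if_half_roots[OF I perfect half] .
  qed
  then show ?thesis
    using perfect nontriv by (auto simp: simple_def)
qed

end

theorem theorem3p5:
  fixes scale :: "'k::field_char_0 \<Rightarrow> 'v::ab_group_add \<Rightarrow> 'v"
    and \<delta> :: 'k
    and br :: "'v \<Rightarrow> 'v \<Rightarrow> 'v"
    and H :: "'v set"
  assumes "delta_jordan_lie scale \<delta> br"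
    and "(UNIV :: 'v set) \<noteq> {0}"
    and "delta_jordan_lie.splitting_cartan_subalgebra scale \<delta> br H"
    and "delta_jordan_lie.symmetric_roots scale br H"
    and "delta_jordan_lie.root_multiplicative scale br H"
    and "delta_jordan_lie.center br = {0}"
    and "delta_jordan_lie.bracket_span scale br UNIV UNIV = UNIV"
    and "\<forall>\<alpha>\<in>delta_jordan_lie.roots scale br H.
           vector_space.dim scale (delta_jordan_lie.root_space scale br H \<alpha>) = 1"
  shows "delta_jordan_lie.simple scale br \<longleftrightarrow>
         (\<forall>\<alpha>\<in>delta_jordan_lie.roots scale br H. \<forall>\<beta>\<in>delta_jordan_lie.roots scale br H.
            delta_jordan_lie.connected_roots scale \<delta> br H \<alpha> \<beta>)"
proof -
  interpret L: delta_jordan_lie scale \<delta> br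
    by (fact assms(1))
  \<comment> \<open>The premises that 2 and 3 are nonzero are discharged by characteristic
    0.\<close>
  have "\<delta> \<noteq> -1"
    using L.trivial_if_delta_minus_one[OF _ _ _ assms(3,6)] assms(2) by auto
  then have one: "\<delta> = 1"
    using L.delta by simp
  interpret symmetric_split_lie scale br H
    using assms(1,3,4,6) unfolding one
    by (auto simp: symmetric_split_lie_def symmetric_split_lie_axioms_def
        split_lie_def split_lie_axioms_def)
  show ?thesis
    unfolding one using simple_imp_connected connected_imp_simple assms(2,5,7,8) by blast
qed

end
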